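(* Let $k$ be a field and let $X$ be a finite nonempty set with $|X|=n$. The Hilbert series of the free dendriform algebra $DD(X)$ over $k$ is $$\mathcal{H}(DD(X),t)=\frac{1-2nt-\sqrt{1-4nt}}{2nt}.$$
   Context: A dendriform algebra over $k$ is a $k$-vector space with bilinear operations $\prec,\succ$ satisfying, for all $x,y,z$: $(x\succ y)\prec z=x\succ(y\prec z)$; $(x\prec y)\prec z=x\prec(y\prec z)+x\prec(y\succ z)$; $x\succ(y\succ z)=(x\succ y)\succ z+(x\prec y)\succ z$. $DD(X)$ is the free dendriform algebra on $X$. Normal $DD$-words over $X$ are the formal expressions defined recursively as: $x$; $x\prec v$; $x\succ v$; $(x\succ u_1)\succ u_2$; where $x\in X$ and $v,u_1,u_2$ are normal $DD$-words. The degree of a word is the number of occurrences of elements of $X$ in it. $DD_m$ is the subspace of $DD(X)$ spanned by all normal $DD$-words of degree $m$ (evaluated in $DD(X)$). This makes $DD(X)=\bigoplus_{m\ge1}DD_m$ a finitely graded dendriform algebra (each $DD_m$ is finite-dimensional and $\delta(DD_i,DD_j)\subseteq DD_{i+j}$ for $\delta\in\{\prec,\succ\}$, $i,j\ge1$). Its Hilbert series is $\mathcal{H}(DD(X),t)=\sum_{m=1}^{\infty}\dim_k(DD_m)\,t^m$. The square root $\sqrt{1-4nt}$ denotes the power series in $t$ with constant term $1$ whose square is $1-4nt$. *)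

theory Defs
  imports
    "HOL-Library.Poly_Mapping"
    "HOL-Library.Cardinality"
    "HOL-Computational_Algebra.Formal_Power_Series"
begin

section \<open>Dendriform algebras\<close>

locale dendriform_algebra = vector_space scale
  for scale :: "'k::field \<Rightarrow> 'a::ab_group_add \<Rightarrow> 'a" +
  fixes prec :: "'a \<Rightarrow> 'a \<Rightarrow> 'a" (infix \<open>\<prec>\<close> 70)
    and succ :: "'a \<Rightarrow> 'a \<Rightarrow> 'a" (infix \<open>\<succ>\<close> 70)
  assumes linear_prec_left: "Vector_Spaces.linear scale scale (\<lambda>x. x \<prec> y)"
    and linear_prec_right: "Vector_Spaces.linear scale scale (\<lambda>y. x \<prec> y)"
    and linear_succ_left: "Vector_Spaces.linear scale scale (\<lambda>x. x \<succ> y)"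
    and linear_succ_right: "Vector_Spaces.linear scale scale (\<lambda>y. x \<succ> y)"
    and succ_prec: "(x \<succ> y) \<prec> z = x \<succ> (y \<prec> z)"
    and prec_prec: "(x \<prec> y) \<prec> z = x \<prec> (y \<prec> z) + x \<prec> (y \<succ> z)"
    and succ_succ: "x \<succ> (y \<succ> z) = (x \<succ> y) \<succ> z + (x \<prec> y) \<succ> z"


section \<open>The free dendriform algebra\<close>

text \<open>
  The free dendriform algebra on the set of all elements of a type \<open>'x\<close> is the free
  nonassociative algebra with two bilinear operations on \<open>'x\<close>, that is, the vector space with
  basis the formal expressions in \<open>'x\<close>, modulo the ideal generated by the dendriform identities.
\<close>

datatype 'x expr = Gen 'x | Prec "'x expr" "'x expr" | Succ "'x expr" "'x expr"

primrec expr_degree :: "'x expr \<Rightarrow> nat" where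
  "expr_degree (Gen x) = 1"
| "expr_degree (Prec s t) = expr_degree s + expr_degree t"
| "expr_degree (Succ s t) = expr_degree s + expr_degree t"

primrec expr_eval :: "('x \<Rightarrow> 'a) \<Rightarrow> ('a \<Rightarrow> 'a \<Rightarrow> 'a) \<Rightarrow> ('a \<Rightarrow> 'a \<Rightarrow> 'a) \<Rightarrow> 'x expr \<Rightarrow> 'a" where
  "expr_eval f prec succ (Gen x) = f x"
| "expr_eval f prec succ (Prec s t) = prec (expr_eval f prec succ s) (expr_eval f prec succ t)"
| "expr_eval f prec succ (Succ s t) = succ (expr_eval f prec succ s) (expr_eval f prec succ t)"

type_synonym ('x, 'k) magmatic = "'x expr \<Rightarrow>\<^sub>0 'k"

definition mscale :: "'k::field \<Rightarrow> ('x, 'k) magmatic \<Rightarrow> ('x, 'k) magmatic" where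
  "mscale c p = Poly_Mapping.map ((*) c) p"

definition bilinear_extension ::
  "('x expr \<Rightarrow> 'x expr \<Rightarrow> 'x expr) \<Rightarrow> ('x, 'k::field) magmatic \<Rightarrow> ('x, 'k) magmatic \<Rightarrow> ('x, 'k) magmatic"
  where "bilinear_extension c p q =
    (\<Sum>s\<in>Poly_Mapping.keys p. \<Sum>t\<in>Poly_Mapping.keys q.
       Poly_Mapping.single (c s t) (Poly_Mapping.lookup p s * Poly_Mapping.lookup q t))"

abbreviation mprec :: "('x, 'k::field) magmatic \<Rightarrow> ('x, 'k) magmatic \<Rightarrow> ('x, 'k) magmatic" where
  "mprec \<equiv> bilinear_extension Prec"

abbreviation msucc :: "('x, 'k::field) magmatic \<Rightarrow> ('x, 'k) magmatic \<Rightarrow> ('x, 'k) magmatic" where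
  "msucc \<equiv> bilinear_extension Succ"

inductive_set dendriform_ideal :: "('x, 'k::field) magmatic set" where
  succ_prec: "mprec (msucc x y) z - msucc x (mprec y z) \<in> dendriform_ideal"
| prec_prec: "mprec (mprec x y) z - (mprec x (mprec y z) + mprec x (msucc y z)) \<in> dendriform_ideal"
| succ_succ: "msucc x (msucc y z) - (msucc (msucc x y) z + msucc (mprec x y) z) \<in> dendriform_ideal"
| zero: "0 \<in> dendriform_ideal"
| add: "p \<in> dendriform_ideal \<Longrightarrow> q \<in> dendriform_ideal \<Longrightarrow> p + q \<in> dendriform_ideal"
| scale: "p \<in> dendriform_ideal \<Longrightarrow> mscale c p \<in> dendriform_ideal"
| prec_left: "p \<in> dendriform_ideal \<Longrightarrow> mprec p q \<in> dendriform_ideal"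
| prec_right: "q \<in> dendriform_ideal \<Longrightarrow> mprec p q \<in> dendriform_ideal"
| succ_left: "p \<in> dendriform_ideal \<Longrightarrow> msucc p q \<in> dendriform_ideal"
| succ_right: "q \<in> dendriform_ideal \<Longrightarrow> msucc p q \<in> dendriform_ideal"

lemma lookup_mscale [simp]: "Poly_Mapping.lookup (mscale c p) t = c * Poly_Mapping.lookup p t"
  by (simp add: mscale_def map.rep_eq when_def)

lemma keys_mscale: "Poly_Mapping.keys (mscale c p) \<subseteq> Poly_Mapping.keys p"
  by (auto simp: in_keys_iff)

lemma vector_space_mscale: "vector_space mscale"
  by unfold_locales (auto intro!: poly_mapping_eqI simp: lookup_add algebra_simps)

lemma mscale_single: "mscale c (Poly_Mapping.single t d) = Poly_Mapping.single t (c * d)"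
  by (intro poly_mapping_eqI) (simp add: lookup_single when_def)

lemma mscale_minus_one: "mscale (-1) p = - p"
  by (intro poly_mapping_eqI) simp

lemma mscale_sum: "mscale c (sum g A) = (\<Sum>a\<in>A. mscale c (g a))"
  by (rule module.scale_sum_right) (use vector_space_mscale module_iff_vector_space in blast)

lemma sum_keys_mscale:
  assumes "\<And>t. g t 0 = (0 :: 'b::comm_monoid_add)"
  shows "(\<Sum>t\<in>Poly_Mapping.keys (mscale c p). g t (Poly_Mapping.lookup (mscale c p) t))
       = (\<Sum>t\<in>Poly_Mapping.keys p. g t (c * Poly_Mapping.lookup p t))"
  by (rule sum.mono_neutral_cong_left)
    (use keys_mscale[of c p] assms in \<open>auto simp: in_keys_iff\<close>)

lemma bilinear_extension_add_left:
  "bilinear_extension c (p + p') q = bilinear_extension c p q + bilinear_extension c p' q"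
  unfolding bilinear_extension_def
  by (rule setsum_keys_plus_distrib) (simp_all add: algebra_simps single_add sum.distrib)

lemma bilinear_extension_add_right:
  "bilinear_extension c p (q + q') = bilinear_extension c p q + bilinear_extension c p q'"
proof -
  have "(\<Sum>t\<in>Poly_Mapping.keys (q + q'). Poly_Mapping.single (c s t) (Poly_Mapping.lookup p s * Poly_Mapping.lookup (q + q') t))
    = (\<Sum>t\<in>Poly_Mapping.keys q. Poly_Mapping.single (c s t) (Poly_Mapping.lookup p s * Poly_Mapping.lookup q t))
    + (\<Sum>t\<in>Poly_Mapping.keys q'. Poly_Mapping.single (c s t) (Poly_Mapping.lookup p s * Poly_Mapping.lookup q' t))" for s
    by (rule setsum_keys_plus_distrib) (simp_all add: algebra_simps single_add)
  then show ?thesis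
    by (simp add: bilinear_extension_def sum.distrib)
qed

lemma bilinear_extension_scale_left:
  "bilinear_extension c (mscale a p) q = mscale a (bilinear_extension c p q)"
  unfolding bilinear_extension_def
  by (subst sum_keys_mscale) (simp_all add: mscale_sum mscale_single mult.assoc)

lemma bilinear_extension_scale_right:
  "bilinear_extension c p (mscale a q) = mscale a (bilinear_extension c p q)"
  unfolding bilinear_extension_def
  by (subst sum_keys_mscale) (simp_all add: mscale_sum mscale_single mult_ac)

lemma bilinear_extension_diff_left:
  "bilinear_extension c (p - p') q = bilinear_extension c p q - bilinear_extension c p' q"
  using bilinear_extension_add_left[of c "p - p'" p' q] by (simp add: algebra_simps)

lemma bilinear_extension_diff_right:
  "bilinear_extension c p (q - q') = bilinear_extension c p q - bilinear_extension c p q'"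
  using bilinear_extension_add_right[of c p "q - q'" q'] by (simp add: algebra_simps)

lemma dendriform_ideal_uminus: "p \<in> dendriform_ideal \<Longrightarrow> - p \<in> dendriform_ideal"
  using dendriform_ideal.scale[of p "-1"] by (simp add: mscale_minus_one)

lemma dendriform_ideal_diff:
  "p \<in> dendriform_ideal \<Longrightarrow> q \<in> dendriform_ideal \<Longrightarrow> p - q \<in> dendriform_ideal"
  using dendriform_ideal.add[of p "- q"] dendriform_ideal_uminus[of q] by simp

definition dendriform_equiv :: "('x, 'k::field) magmatic \<Rightarrow> ('x, 'k) magmatic \<Rightarrow> bool" where
  "dendriform_equiv p q \<longleftrightarrow> p - q \<in> dendriform_ideal"

quotient_type (overloaded) ('x, 'k) free_dendriform = "('x, 'k::field) magmatic" / dendriform_equiv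
proof (rule equivpI)
  show "reflp dendriform_equiv"
    by (simp add: reflp_def dendriform_equiv_def dendriform_ideal.zero)
  show "symp dendriform_equiv"
    unfolding symp_def dendriform_equiv_def using dendriform_ideal_uminus by fastforce
  show "transp dendriform_equiv"
    unfolding transp_def dendriform_equiv_def using dendriform_ideal.add by fastforce
qed

instantiation free_dendriform :: (type, field) ab_group_add
begin

lift_definition zero_free_dendriform :: "('a, 'b) free_dendriform" is 0 .

lift_definition plus_free_dendriform ::
  "('a, 'b) free_dendriform \<Rightarrow> ('a, 'b) free_dendriform \<Rightarrow> ('a, 'b) free_dendriform" is "(+)"
  unfolding dendriform_equiv_def using dendriform_ideal.add by (fastforce simp: add_diff_add)

lift_definition uminus_free_dendriform ::
  "('a, 'b) free_dendriform \<Rightarrow> ('a, 'b) free_dendriform" is uminus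
  unfolding dendriform_equiv_def using dendriform_ideal_uminus by fastforce

lift_definition minus_free_dendriform ::
  "('a, 'b) free_dendriform \<Rightarrow> ('a, 'b) free_dendriform \<Rightarrow> ('a, 'b) free_dendriform" is "(-)"
proof -
  fix p p' q q' :: "('a, 'b) magmatic"
  assume "dendriform_equiv p p'" "dendriform_equiv q q'"
  then show "dendriform_equiv (p - q) (p' - q')"
    unfolding dendriform_equiv_def
    using dendriform_ideal_diff[of "p - p'" "q - q'"] by (simp add: algebra_simps)
qed

instance
  by standard (transfer, simp add: dendriform_equiv_def dendriform_ideal.zero algebra_simps)+

end

lift_definition dd_scale :: "'k::field \<Rightarrow> ('x, 'k) free_dendriform \<Rightarrow> ('x, 'k) free_dendriform"
  is mscale
proof -
  fix c :: 'k and p q :: "('x, 'k) magmatic"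
  assume "dendriform_equiv p q"
  then have "mscale c (p - q) \<in> dendriform_ideal"
    by (simp add: dendriform_equiv_def dendriform_ideal.scale)
  moreover have "mscale c (p - q) = mscale c p - mscale c q"
    by (intro poly_mapping_eqI) (simp add: lookup_minus algebra_simps)
  ultimately show "dendriform_equiv (mscale c p) (mscale c q)"
    by (simp add: dendriform_equiv_def)
qed

lift_definition dd_prec ::
  "('x, 'k::field) free_dendriform \<Rightarrow> ('x, 'k) free_dendriform \<Rightarrow> ('x, 'k) free_dendriform"
  is mprec
proof -
  fix p p' q q' :: "('x, 'k) magmatic"
  assume "dendriform_equiv p p'" "dendriform_equiv q q'"
  then have "mprec (p - p') q + mprec p' (q - q') \<in> dendriform_ideal"
    by (simp add: dendriform_equiv_def dendriform_ideal.intros)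
  then show "dendriform_equiv (mprec p q) (mprec p' q')"
    by (simp add: dendriform_equiv_def bilinear_extension_diff_left bilinear_extension_diff_right)
qed

lift_definition dd_succ ::
  "('x, 'k::field) free_dendriform \<Rightarrow> ('x, 'k) free_dendriform \<Rightarrow> ('x, 'k) free_dendriform"
  is msucc
proof -
  fix p p' q q' :: "('x, 'k) magmatic"
  assume "dendriform_equiv p p'" "dendriform_equiv q q'"
  then have "msucc (p - p') q + msucc p' (q - q') \<in> dendriform_ideal"
    by (simp add: dendriform_equiv_def dendriform_ideal.intros)
  then show "dendriform_equiv (msucc p q) (msucc p' q')"
    by (simp add: dendriform_equiv_def bilinear_extension_diff_left bilinear_extension_diff_right)
qed

lift_definition dd_gen :: "'x \<Rightarrow> ('x, 'k::field) free_dendriform"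
  is "\<lambda>x. Poly_Mapping.single (Gen x) 1" .

lemma dendriform_equiv_refl: "dendriform_equiv p p"
  by (simp add: dendriform_equiv_def dendriform_ideal.zero)

global_interpretation dd: vector_space
  "dd_scale :: 'k::field \<Rightarrow> ('x, 'k) free_dendriform \<Rightarrow> ('x, 'k) free_dendriform"
proof
  fix a b :: 'k and x y :: "('x, 'k) free_dendriform"
  interpret m: vector_space "mscale :: 'k \<Rightarrow> ('x, 'k) magmatic \<Rightarrow> _" by (rule vector_space_mscale)
  show "dd_scale a (x + y) = dd_scale a x + dd_scale a y"
    by transfer (simp add: m.scale_right_distrib dendriform_equiv_refl)
  show "dd_scale (a + b) x = dd_scale a x + dd_scale b x"
    by transfer (simp add: m.scale_left_distrib dendriform_equiv_refl)
  show "dd_scale a (dd_scale b x) = dd_scale (a * b) x"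
    by transfer (simp add: dendriform_equiv_refl)
  show "dd_scale 1 x = x"
    by transfer (simp add: dendriform_equiv_refl)
qed

global_interpretation dd: dendriform_algebra
  "dd_scale :: 'k::field \<Rightarrow> ('x, 'k) free_dendriform \<Rightarrow> ('x, 'k) free_dendriform" dd_prec dd_succ
proof
  fix x y z :: "('x, 'k) free_dendriform" and c :: 'k
  show "dd_prec (dd_succ x y) z = dd_succ x (dd_prec y z)"
    by transfer (simp add: dendriform_equiv_def dendriform_ideal.succ_prec)
  show "dd_prec (dd_prec x y) z = dd_prec x (dd_prec y z) + dd_prec x (dd_succ y z)"
    by transfer (simp only: dendriform_equiv_def dendriform_ideal.prec_prec)
  show "dd_succ x (dd_succ y z) = dd_succ (dd_succ x y) z + dd_succ (dd_prec x y) z"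
    by transfer (simp only: dendriform_equiv_def dendriform_ideal.succ_succ)
qed (transfer, simp add: bilinear_extension_add_left bilinear_extension_add_right
    bilinear_extension_scale_left bilinear_extension_scale_right dendriform_equiv_refl)+

text \<open>The universal property.\<close>

definition dendriform_hom ::
  "('k::field \<Rightarrow> 'a::ab_group_add \<Rightarrow> 'a) \<Rightarrow> ('a \<Rightarrow> 'a \<Rightarrow> 'a) \<Rightarrow> ('a \<Rightarrow> 'a \<Rightarrow> 'a) \<Rightarrow>
   ('k \<Rightarrow> 'b::ab_group_add \<Rightarrow> 'b) \<Rightarrow> ('b \<Rightarrow> 'b \<Rightarrow> 'b) \<Rightarrow> ('b \<Rightarrow> 'b \<Rightarrow> 'b) \<Rightarrow> ('a \<Rightarrow> 'b) \<Rightarrow> bool"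
  where "dendriform_hom scale prec succ scale' prec' succ' h \<longleftrightarrow>
    Vector_Spaces.linear scale scale' h \<and>
    (\<forall>x y. h (prec x y) = prec' (h x) (h y)) \<and> (\<forall>x y. h (succ x y) = succ' (h x) (h y))"

lemma bilinear_extension_single:
  "bilinear_extension c (Poly_Mapping.single s 1) (Poly_Mapping.single t 1) = Poly_Mapping.single (c s t) 1"
  by (simp add: bilinear_extension_def)

lemma expr_eval_dd:
  "expr_eval dd_gen dd_prec dd_succ t
   = (abs_free_dendriform (Poly_Mapping.single t 1) :: ('x, 'k::field) free_dendriform)"
  by (induction t)
    (simp_all add: dd_gen.abs_eq dd_prec.abs_eq dd_succ.abs_eq bilinear_extension_single)

lemma abs_free_dendriform_sum:
  "abs_free_dendriform (sum g A) = (\<Sum>a\<in>A. abs_free_dendriform (g a))"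
  by (induction A rule: infinite_finite_induct)
    (simp_all add: zero_free_dendriform.abs_eq flip: plus_free_dendriform.abs_eq)

lemma magmatic_expand: "p = (\<Sum>t\<in>Poly_Mapping.keys p. mscale (Poly_Mapping.lookup p t) (Poly_Mapping.single t 1))"
proof (rule poly_mapping_eqI)
  fix s
  have "(\<Sum>t\<in>Poly_Mapping.keys p. Poly_Mapping.lookup (mscale (Poly_Mapping.lookup p t) (Poly_Mapping.single t 1)) s)
      = (\<Sum>t\<in>Poly_Mapping.keys p. if s = t then Poly_Mapping.lookup p s else 0)"
    by (rule sum.cong) (auto simp: lookup_single when_def)
  then show "Poly_Mapping.lookup p s = Poly_Mapping.lookup (\<Sum>t\<in>Poly_Mapping.keys p. mscale (Poly_Mapping.lookup p t) (Poly_Mapping.single t 1)) s"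
    by (simp add: lookup_sum in_keys_iff)
qed

lemma abs_free_dendriform_expand:
  "abs_free_dendriform p
   = (\<Sum>t\<in>Poly_Mapping.keys p. dd_scale (Poly_Mapping.lookup p t) (expr_eval dd_gen dd_prec dd_succ t))"
  by (subst magmatic_expand)
    (simp add: abs_free_dendriform_sum expr_eval_dd dd_scale.abs_eq)

theorem free_dendriform_universal:
  fixes f :: "'x \<Rightarrow> 'b::ab_group_add" and scale :: "'k::field \<Rightarrow> 'b \<Rightarrow> 'b"
  assumes "dendriform_algebra scale prec succ"
  shows "\<exists>!h. dendriform_hom dd_scale dd_prec dd_succ scale prec succ h \<and> (\<forall>x. h (dd_gen x) = f x)"
proof (rule ex_ex1I)
  interpret B: dendriform_algebra scale prec succ by fact
  let ?ev = "expr_eval f prec succ"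
  define \<phi> where "\<phi> p = (\<Sum>t\<in>Poly_Mapping.keys p. scale (Poly_Mapping.lookup p t) (?ev t))" for p :: "('x, 'k) magmatic"
  have add: "\<phi> (p + q) = \<phi> p + \<phi> q" for p q
    unfolding \<phi>_def by (rule setsum_keys_plus_distrib) (simp_all add: B.scale_left_distrib)
  have scl: "\<phi> (mscale c p) = scale c (\<phi> p)" for c p
    unfolding \<phi>_def by (subst sum_keys_mscale) (simp_all add: B.scale_sum_right)
  have zero: "\<phi> 0 = 0" by (simp add: \<phi>_def)
  have diff: "\<phi> (p - q) = \<phi> p - \<phi> q" for p q
    using add[of "p - q" q] by (simp add: algebra_simps)
  have sums: "\<phi> (sum g A) = (\<Sum>a\<in>A. \<phi> (g a))" for g and A :: "'x expr set"
    by (induction A rule: infinite_finite_induct) (simp_all add: zero add)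
  have single: "\<phi> (Poly_Mapping.single t c) = scale c (?ev t)" for t c
    by (cases "c = 0") (simp_all add: \<phi>_def)
  have hom: "\<phi> (bilinear_extension c p q) = op (\<phi> p) (\<phi> q)"
    if c: "\<And>s t. ?ev (c s t) = op (?ev s) (?ev t)"
      and l: "\<And>y. Vector_Spaces.linear scale scale (\<lambda>x. op x y)"
      and r: "\<And>x. Vector_Spaces.linear scale scale (\<lambda>y. op x y)" for c op p q
  proof -
    interpret l: Vector_Spaces.linear scale scale "\<lambda>x. op x y" for y by (rule l)
    interpret r: Vector_Spaces.linear scale scale "\<lambda>y. op x y" for x by (rule r)
    show ?thesis
      by (simp add: bilinear_extension_def sums single c)
        (simp add: \<phi>_def l.sum r.sum l.scale r.scale B.scale_sum_right, subst sum.swap, simp add: mult.commute)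
  qed
  have prec: "\<phi> (mprec p q) = prec (\<phi> p) (\<phi> q)" for p q
    by (rule hom) (auto intro: B.linear_prec_left B.linear_prec_right)
  have succ: "\<phi> (msucc p q) = succ (\<phi> p) (\<phi> q)" for p q
    by (rule hom) (auto intro: B.linear_succ_left B.linear_succ_right)
  have zl: "prec 0 y = 0" "succ 0 y = 0" "prec y 0 = 0" "succ y 0 = 0" for y
    using B.linear_prec_left B.linear_prec_right B.linear_succ_left B.linear_succ_right
    by (metis module_hom.zero module_hom_iff_linear)+
  have ideal: "\<phi> p = 0" if "p \<in> dendriform_ideal" for p
    using that
    by induction (simp_all add: zero add scl diff prec succ zl B.succ_prec B.prec_prec B.succ_succ)
  have wd: "\<phi> p = \<phi> q" if "dendriform_equiv p q" for p q
    using ideal[of "p - q"] that by (simp add: dendriform_equiv_def diff)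
  define h where "h z = \<phi> (rep_free_dendriform z)" for z
  have h: "h (abs_free_dendriform p) = \<phi> p" for p
    unfolding h_def
    by (rule wd) (meson Quotient3_free_dendriform dendriform_equiv_refl rep_abs_rsp_left)
  have surj: "\<exists>p. z = abs_free_dendriform p" for z :: "('x, 'k) free_dendriform"
    by (metis Quotient3_abs_rep Quotient3_free_dendriform)
  have "Vector_Spaces.linear dd_scale scale h"
  proof (unfold Vector_Spaces.linear_iff, intro conjI allI)
    show "vector_space dd_scale" by (rule dd.vector_space_axioms)
    show "vector_space scale" by (rule B.vector_space_axioms)
    fix y z :: "('x, 'k) free_dendriform" and c
    obtain p q where "y = abs_free_dendriform p" "z = abs_free_dendriform q" using surj by metis
    then show "h (y + z) = h y + h z" "h (dd_scale c y) = scale c (h y)"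
      by (simp_all add: plus_free_dendriform.abs_eq dd_scale.abs_eq h add scl)
  qed
  moreover have "h (dd_prec y z) = prec (h y) (h z) \<and> h (dd_succ y z) = succ (h y) (h z)" for y z
  proof -
    obtain p q where "y = abs_free_dendriform p" "z = abs_free_dendriform q" using surj by metis
    then show ?thesis by (simp add: dd_prec.abs_eq dd_succ.abs_eq h prec succ)
  qed
  moreover have "h (dd_gen x) = f x" for x
    by (simp add: dd_gen.abs_eq h single)
  ultimately show "\<exists>h. dendriform_hom dd_scale dd_prec dd_succ scale prec succ h \<and> (\<forall>x. h (dd_gen x) = f x)"
    unfolding dendriform_hom_def by blast
next
  have expand: "h (abs_free_dendriform p)
      = (\<Sum>t\<in>Poly_Mapping.keys p. scale (Poly_Mapping.lookup p t) (expr_eval f prec succ t))"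
    if "dendriform_hom dd_scale dd_prec dd_succ scale prec succ h \<and> (\<forall>x. h (dd_gen x) = f x)" for h p
  proof -
    interpret Vector_Spaces.linear dd_scale scale h using that by (simp add: dendriform_hom_def)
    have "h (expr_eval dd_gen dd_prec dd_succ t) = expr_eval f prec succ t" for t
      using that by (induction t) (simp_all add: dendriform_hom_def)
    then show ?thesis by (simp add: abs_free_dendriform_expand sum scale)
  qed
  fix h h'
  assume h: "dendriform_hom dd_scale dd_prec dd_succ scale prec succ h \<and> (\<forall>x. h (dd_gen x) = f x)"
    and h': "dendriform_hom dd_scale dd_prec dd_succ scale prec succ h' \<and> (\<forall>x. h' (dd_gen x) = f x)"
  show "h = h'"
  proof
    fix z :: "('x, 'k) free_dendriform"
    have "z = abs_free_dendriform (rep_free_dendriform z)"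
      by (metis Quotient3_abs_rep Quotient3_free_dendriform)
    then show "h z = h' z" using expand[OF h] expand[OF h'] by metis
  qed
qed


section \<open>Normal words and the Hilbert series\<close>

inductive_set normal_words :: "'x expr set" where
  "Gen x \<in> normal_words"
| "v \<in> normal_words \<Longrightarrow> Prec (Gen x) v \<in> normal_words"
| "v \<in> normal_words \<Longrightarrow> Succ (Gen x) v \<in> normal_words"
| "u\<^sub>1 \<in> normal_words \<Longrightarrow> u\<^sub>2 \<in> normal_words \<Longrightarrow> Succ (Succ (Gen x) u\<^sub>1) u\<^sub>2 \<in> normal_words"

definition DD :: "nat \<Rightarrow> ('x, 'k::field) free_dendriform set" where
  "DD m = dd.span (expr_eval dd_gen dd_prec dd_succ ` {w \<in> normal_words. expr_degree w = m})"

text \<open>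
  The Hilbert series of a family of subspaces indexed by the positive integers; the subspace with
  index \<open>0\<close> is disregarded. The coefficients are taken in \<open>\<rat>\<close> irrespective of the field \<open>'k\<close>.
\<close>

definition hilbert_series :: "(nat \<Rightarrow> ('x, 'k::field) free_dendriform set) \<Rightarrow> rat fps" where
  "hilbert_series V = Abs_fps (\<lambda>m. if m = 0 then 0 else of_nat (dd.dim (V m)))"

definition fps_sqrt :: "rat fps \<Rightarrow> rat fps" where
  "fps_sqrt f = (THE s. fps_nth s 0 = 1 \<and> s\<^sup>2 = f)"

lemma fps_sqrt_unique:
  assumes "fps_nth f 0 = 1"
  shows "\<exists>!s :: rat fps. fps_nth s 0 = 1 \<and> s\<^sup>2 = f"
proof (rule ex_ex1I)
  let ?s = "fps_radical (\<lambda>_ _. 1) 2 f"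
  have "?s ^ Suc 1 = f"
    using power_radical[of f "\<lambda>_ _. 1" 1] assms by (simp add: numeral_2_eq_2)
  then show "\<exists>s :: rat fps. fps_nth s 0 = 1 \<and> s\<^sup>2 = f"
    by (intro exI[of _ ?s]) (simp add: numeral_2_eq_2)
next
  fix s r :: "rat fps"
  assume "fps_nth s 0 = 1 \<and> s\<^sup>2 = f" "fps_nth r 0 = 1 \<and> r\<^sup>2 = f"
  then have "s\<^sup>2 = r\<^sup>2" "fps_nth s 0 \<noteq> fps_nth (- r) 0" by auto
  then show "s = r" by (metis power2_eq_iff)
qed

text \<open>
  Division of formal power series by a non-unit such as \<open>2nt\<close> truncates in general; here the
  numerator is divisible by \<open>2nt\<close>, so the quotient is the exact one.
\<close>

lemma dvd_numerator:
  fixes n :: nat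
  assumes "n > 0"
  shows "2 * of_nat n * fps_X dvd
    (1 - 2 * of_nat n * fps_X - fps_sqrt (1 - 4 * of_nat n * fps_X) :: rat fps)"
proof -
  let ?s = "fps_sqrt (1 - 4 * of_nat n * fps_X)"
  have "fps_nth ?s 0 = 1"
    using theI'[OF fps_sqrt_unique[of "1 - 4 * of_nat n * fps_X"]] by (simp add: fps_sqrt_def)
  then have "fps_nth (1 - 2 * of_nat n * fps_X - ?s) 0 = 0" by simp
  moreover have "fps_nth (2 * of_nat n * fps_X :: rat fps) 1 \<noteq> 0"
    using assms by (simp add: numeral_fps_const fps_of_nat[symmetric])
  then have "2 * of_nat n * fps_X \<noteq> (0 :: rat fps)" "subdegree (2 * of_nat n * fps_X :: rat fps) = 1"
    by (auto intro: subdegreeI)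
  ultimately show ?thesis
    by (cases "1 - 2 * of_nat n * fps_X - ?s = 0") (auto simp: fps_dvd_iff Suc_le_eq subdegree_eq_0_iff intro!: gr0I)
qed

end

theory Submission
  imports Defs "HOL-Library.Tree" "HOL-Library.Function_Algebras"
begin

text \<open>
  Rewriting a product of normal words with the dendriform identities shows that the normal words
  of degree \<open>m\<close> span all monomials of degree \<open>m\<close>. There are as many of them as binary trees with
  \<open>m\<close> labelled inner nodes. Conversely, functions on labelled trees form a dendriform algebra (the
  completed Loday--Ronco algebra, described through the dual coproduct, which cuts a tree along
  the path from the root to a leaf), and every indicator function of a tree with \<open>m\<close> nodes is the
  value of a monomial of degree \<open>m\<close>. So the dimension of \<open>DD\<^sub>m\<close> is exactly the number of trees,
  whose generating function \<open>C\<close> satisfies \<open>C = 1 + n t C\<^sup>2\<close>.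
\<close>

section \<open>Products of normal words\<close>

lemma dd_linear_left:
  "dd_prec (x + y) z = dd_prec x z + dd_prec y z" "dd_succ (x + y) z = dd_succ x z + dd_succ y z"
  "dd_prec (dd_scale c x) z = dd_scale c (dd_prec x z)"
  "dd_succ (dd_scale c x) z = dd_scale c (dd_succ x z)"
  "dd_prec 0 z = 0" "dd_succ 0 z = 0"
  using dd.linear_prec_left[of z] dd.linear_succ_left[of z]
  by (auto simp: Vector_Spaces.linear_iff)
    (metis add_cancel_right_right)+

lemma dd_linear_right:
  "dd_prec z (x + y) = dd_prec z x + dd_prec z y" "dd_succ z (x + y) = dd_succ z x + dd_succ z y"
  "dd_prec z (dd_scale c x) = dd_scale c (dd_prec z x)"
  "dd_succ z (dd_scale c x) = dd_scale c (dd_succ z x)"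
  "dd_prec z 0 = 0" "dd_succ z 0 = 0"
  using dd.linear_prec_right[of z] dd.linear_succ_right[of z]
  by (auto simp: Vector_Spaces.linear_iff)
    (metis add_cancel_right_right)+

lemma DD_0: "0 \<in> DD m"
  and DD_add: "u \<in> DD m \<Longrightarrow> v \<in> DD m \<Longrightarrow> u + v \<in> DD m"
  and DD_diff: "u \<in> DD m \<Longrightarrow> v \<in> DD m \<Longrightarrow> u - v \<in> DD m"
  and DD_scale: "u \<in> DD m \<Longrightarrow> dd_scale c u \<in> DD m"
  by (simp_all add: DD_def dd.span_zero dd.span_add dd.span_diff dd.span_scale)

lemma DD_word: "w \<in> normal_words \<Longrightarrow> expr_eval dd_gen dd_prec dd_succ w \<in> DD (expr_degree w)"
  by (auto simp: DD_def intro: dd.span_base)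

lemma DD_induct [consumes 1, case_names zero add scale word]:
  assumes "v \<in> DD m" "P 0" "\<And>u v. P u \<Longrightarrow> P v \<Longrightarrow> P (u + v)"
    "\<And>c u. P u \<Longrightarrow> P (dd_scale c u)"
    "\<And>w. w \<in> normal_words \<Longrightarrow> expr_degree w = m \<Longrightarrow> P (expr_eval dd_gen dd_prec dd_succ w)"
  shows "P v"
  using assms(1) unfolding DD_def
  by (rule dd.span_induct_alt) (use assms in auto)

lemma gen_prec_DD: "v \<in> DD m \<Longrightarrow> dd_prec (dd_gen x) v \<in> DD (Suc m)"
proof (induction rule: DD_induct)
  case (word w)
  with DD_word[of "Prec (Gen x) w"] show ?case by (simp add: normal_words.intros)
qed (simp_all add: dd_linear_right DD_0 DD_add DD_scale)

lemma gen_succ_DD: "v \<in> DD m \<Longrightarrow> dd_succ (dd_gen x) v \<in> DD (Suc m)"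
proof (induction rule: DD_induct)
  case (word w)
  with DD_word[of "Succ (Gen x) w"] show ?case by (simp add: normal_words.intros)
qed (simp_all add: dd_linear_right DD_0 DD_add DD_scale)

lemma gen_succ_succ_DD:
  assumes "u \<in> DD i" "v \<in> DD j"
  shows "dd_succ (dd_succ (dd_gen x) u) v \<in> DD (Suc (i + j))"
  using assms
proof (induction rule: DD_induct)
  case (word w)
  note w = word(1,2)
  from word(3) show ?case
  proof (induction rule: DD_induct)
    case (word w')
    with DD_word[of "Succ (Succ (Gen x) w) w'"] w show ?case by (simp add: normal_words.intros)
  qed (simp_all add: dd_linear_right DD_0 DD_add DD_scale)
qed (simp_all add: dd_linear_left dd_linear_right DD_0 DD_add DD_scale)

text \<open>In each case the dendriform identities leave products of the shapes allowed in normal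
  words, whose arguments are normal words, \<open>v\<close>, or products with a shorter word on the
  left. Both operations are treated together because the case \<open>Prec (Gen x) a\<close> needs
  both for \<open>a\<close>; \<open>v\<close> and \<open>j\<close> vary because the last case
  applies the hypothesis for \<open>a\<close> to the word \<open>b\<close>.\<close>

lemma DD_mult_word:
  assumes "w \<in> normal_words" "v \<in> DD j"
  shows "dd_prec (expr_eval dd_gen dd_prec dd_succ w) v \<in> DD (expr_degree w + j) \<and>
    dd_succ (expr_eval dd_gen dd_prec dd_succ w) v \<in> DD (expr_degree w + j)"
  using assms
proof (induction w arbitrary: v j rule: normal_words.induct)
  case (1 x)
  then show ?case by (simp add: gen_prec_DD gen_succ_DD)
next
  case (2 a x)
  let ?a = "expr_eval dd_gen dd_prec dd_succ a" and ?x = "dd_gen x"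
  have "dd_prec (dd_prec ?x ?a) v = dd_prec ?x (dd_prec ?a v + dd_succ ?a v)"
    by (simp add: dd.prec_prec dd_linear_right)
  moreover have "dd_succ (dd_prec ?x ?a) v = dd_succ ?x (dd_succ ?a v) - dd_succ (dd_succ ?x ?a) v"
    by (simp add: dd.succ_succ)
  moreover have "dd_prec ?x (dd_prec ?a v + dd_succ ?a v) \<in> DD (Suc (expr_degree a + j))"
    using 2 by (intro gen_prec_DD DD_add) auto
  moreover have "dd_succ ?x (dd_succ ?a v) \<in> DD (Suc (expr_degree a + j))"
    using 2 by (intro gen_succ_DD) auto
  moreover have "dd_succ (dd_succ ?x ?a) v \<in> DD (Suc (expr_degree a + j))"
    using 2 by (intro gen_succ_succ_DD DD_word)
  ultimately show ?case
    by (simp add: DD_diff)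
next
  case (3 a x)
  moreover from 3 have "dd_succ (dd_succ (dd_gen x) (expr_eval dd_gen dd_prec dd_succ a)) v
      \<in> DD (Suc (expr_degree a + j))"
    by (intro gen_succ_succ_DD DD_word)
  ultimately show ?case by (simp add: dd.succ_prec gen_succ_DD)
next
  case (4 a b x)
  let ?a = "expr_eval dd_gen dd_prec dd_succ a" and ?x = "dd_gen x"
  let ?b = "expr_eval dd_gen dd_prec dd_succ b"
  \<comment> \<open>This nesting is too deep for a normal word. The third identity, solved for it,
    leaves a correction term in which the first identity moves \<open>b\<close> next to
    \<open>a\<close>.\<close>
  have "dd_succ (dd_succ (dd_succ ?x ?a) ?b) v
      = dd_succ (dd_succ ?x ?a) (dd_succ ?b v) - dd_succ (dd_succ ?x (dd_prec ?a ?b)) v"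
    by (simp add: dd.succ_succ[of "dd_succ ?x ?a"] dd.succ_prec)
  moreover have "dd_succ (dd_succ ?x ?a) (dd_succ ?b v) \<in> DD (Suc (expr_degree a + (expr_degree b + j)))"
    using 4 DD_word[OF 4(1)] by (intro gen_succ_succ_DD) auto
  moreover have "dd_succ (dd_succ ?x ?a) (dd_prec ?b v) \<in> DD (Suc (expr_degree a + (expr_degree b + j)))"
    using 4 DD_word[OF 4(1)] by (intro gen_succ_succ_DD) auto
  moreover have "dd_succ (dd_succ ?x (dd_prec ?a ?b)) v \<in> DD (Suc ((expr_degree a + expr_degree b) + j))"
    using 4 DD_word[OF 4(2)] by (intro gen_succ_succ_DD) auto
  ultimately show ?case
    by (simp add: dd.succ_prec DD_diff add.assoc)
qed

lemma DD_mult: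
  assumes "u \<in> DD i" "v \<in> DD j"
  shows "dd_prec u v \<in> DD (i + j) \<and> dd_succ u v \<in> DD (i + j)"
  using assms
proof (induction rule: DD_induct)
  case (word w)
  with DD_mult_word[OF word(1,3)] show ?case by simp
qed (simp_all add: dd_linear_left DD_0 DD_add DD_scale)

text \<open>For the lower bound on the dimension: the monomials that realise indicators of trees are
  not normal words in general.\<close>

lemma expr_eval_in_DD: "expr_eval dd_gen dd_prec dd_succ e \<in> DD (expr_degree e)"
proof (induction e)
  case (Gen x)
  show ?case using DD_word[of "Gen x"] by (simp add: normal_words.intros)
qed (simp_all add: DD_mult)

section \<open>The dendriform algebra of functions on labelled trees\<close>

text \<open>
  A leaf of a tree determines a path from the root, and the path splits the tree into a left and a
  right part; \<open>cut_sum t F\<close> is the sum of \<open>F\<close> over all these splittings of \<open>t\<close>.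
\<close>

primrec cut_sum :: "'x tree \<Rightarrow> ('x tree \<Rightarrow> 'x tree \<Rightarrow> 'k::comm_semiring_0) \<Rightarrow> 'k" where
  "cut_sum Leaf F = F Leaf Leaf"
| "cut_sum (Node a x b) F = cut_sum a (\<lambda>p q. F p (Node q x b)) + cut_sum b (\<lambda>p q. F (Node a x p) q)"

lemma cut_sum_add: "cut_sum t (\<lambda>p q. F p q + G p q) = cut_sum t F + cut_sum t G"
  by (induction t arbitrary: F G) (simp_all add: ac_simps)

lemma cut_sum_mult_left: "cut_sum t (\<lambda>p q. c * F p q) = c * cut_sum t F"
  by (induction t arbitrary: F) (simp_all add: distrib_left)

lemma cut_sum_mult_right: "cut_sum t (\<lambda>p q. F p q * c) = cut_sum t F * c"
  by (induction t arbitrary: F) (simp_all add: distrib_right)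

lemma cut_sum_0 [simp]: "cut_sum t (\<lambda>p q. 0) = 0"
  by (induction t) simp_all

lemma cut_sum_swap:
  "cut_sum s (\<lambda>p q. cut_sum t (\<lambda>p' q'. F p q p' q')) = cut_sum t (\<lambda>p' q'. cut_sum s (\<lambda>p q. F p q p' q'))"
  by (induction s arbitrary: F) (simp_all add: cut_sum_add)

text \<open>Both sides sum over pairs of cuts into three parts. At a node, either both cuts run
  through \<open>a\<close>, or both through \<open>b\<close>, or one through each; the mixed terms
  agree by \<open>cut_sum_swap\<close>.\<close>

lemma cut_sum_coassoc:
  "cut_sum t (\<lambda>p q. cut_sum p (\<lambda>p1 p2. G p1 p2 q)) = cut_sum t (\<lambda>p q. cut_sum q (\<lambda>q1 q2. G p q1 q2))"
proof (induction t arbitrary: G)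
  case (Node a x b)
  show ?case
    by (simp add: cut_sum_add Node.IH cut_sum_swap[of a b] add.assoc)
qed simp

text \<open>Only the path to the leftmost leaf has an empty left part, and its right part is the
  whole tree.\<close>

lemma cut_sum_Leaf_left: "cut_sum t (\<lambda>p q. if p = Leaf then F q else 0) = F t"
  by (induction t arbitrary: F) simp_all

lemma cut_sum_Leaf_right: "cut_sum t (\<lambda>p q. if q = Leaf then F p else 0) = F t"
  by (induction t arbitrary: F) simp_all

text \<open>
  The value of a function at the empty tree is meant to be zero. Cutting it off in the products
  makes the identities hold for all functions, so that no subtype is needed.
\<close>

definition off_leaf :: "('x tree \<Rightarrow> 'k::zero) \<Rightarrow> 'x tree \<Rightarrow> 'k" where
  "off_leaf f t = (if t = Leaf then 0 else f t)"

text \<open>The cuts are divided by the part that receives the root: the left part for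
  \<open>tree_prec\<close>, the right part for \<open>tree_succ\<close>. \<open>off_leaf\<close>
  guards the other part, which may be empty.\<close>

fun tree_prec :: "('x tree \<Rightarrow> 'k::field) \<Rightarrow> ('x tree \<Rightarrow> 'k) \<Rightarrow> 'x tree \<Rightarrow> 'k" where
  "tree_prec f g Leaf = 0"
| "tree_prec f g (Node a x b) = cut_sum b (\<lambda>p q. f (Node a x p) * off_leaf g q)"

fun tree_succ :: "('x tree \<Rightarrow> 'k::field) \<Rightarrow> ('x tree \<Rightarrow> 'k) \<Rightarrow> 'x tree \<Rightarrow> 'k" where
  "tree_succ f g Leaf = 0"
| "tree_succ f g (Node a x b) = cut_sum a (\<lambda>p q. off_leaf f p * g (Node q x b))"

definition tree_scale :: "'k::field \<Rightarrow> ('x tree \<Rightarrow> 'k) \<Rightarrow> 'x tree \<Rightarrow> 'k" where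
  "tree_scale c f t = c * f t"

lemma off_leaf_simps [simp]:
  "off_leaf f (Node a x b) = f (Node a x b)" "off_leaf f Leaf = 0"
  by (simp_all add: off_leaf_def)

lemma off_leaf_add: "off_leaf (f + g) t = off_leaf f t + off_leaf (g :: _ \<Rightarrow> 'k::field) t"
  and off_leaf_scale: "off_leaf (tree_scale c f) t = c * off_leaf f t"
  by (simp_all add: off_leaf_def tree_scale_def)

text \<open>All cuts into two nonempty parts together give the sum of the two products, which is the
  associative product occurring in the second and third dendriform identities.\<close>

lemma cut_sum_off_leaf:
  "cut_sum t (\<lambda>p q. off_leaf f p * off_leaf g q) = off_leaf (tree_prec f g + tree_succ f g) t"
  by (cases t) (simp_all add: add.commute)

lemma vector_space_tree_scale: "vector_space (tree_scale :: 'k::field \<Rightarrow> ('x tree \<Rightarrow> 'k) \<Rightarrow> _)"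
  by unfold_locales (auto simp: tree_scale_def fun_eq_iff algebra_simps)

text \<open>Each identity computes a sum over two cuts in two ways. If the root lies in the middle
  part, the cuts run through different subtrees and commute; if it lies in an outer part, both run
  through the same subtree and coassociativity applies.\<close>

lemma dendriform_algebra_tree:
  "dendriform_algebra (tree_scale :: 'k::field \<Rightarrow> ('x tree \<Rightarrow> 'k) \<Rightarrow> _) tree_prec tree_succ"
proof (intro dendriform_algebra.intro dendriform_algebra_axioms.intro vector_space_tree_scale)
  fix f g h :: "'x tree \<Rightarrow> 'k" and t :: "'x tree" and c :: 'k
  have "tree_prec (f + g) h t = tree_prec f h t + tree_prec g h t"
    "tree_prec (tree_scale c f) h t = c * tree_prec f h t"
    "tree_prec h (f + g) t = tree_prec h f t + tree_prec h g t"
    "tree_prec h (tree_scale c f) t = c * tree_prec h f t"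
    "tree_succ (f + g) h t = tree_succ f h t + tree_succ g h t"
    "tree_succ (tree_scale c f) h t = c * tree_succ f h t"
    "tree_succ h (f + g) t = tree_succ h f t + tree_succ h g t"
    "tree_succ h (tree_scale c f) t = c * tree_succ h f t" for f g h :: "'x tree \<Rightarrow> 'k" and c t
    by (cases t; simp add: off_leaf_add off_leaf_scale tree_scale_def distrib_left distrib_right
        cut_sum_add mult.assoc mult.left_commute[of _ c] cut_sum_mult_left)+
  then show "Vector_Spaces.linear tree_scale tree_scale (\<lambda>f. tree_prec f h)"
    "Vector_Spaces.linear tree_scale tree_scale (\<lambda>f. tree_prec h f)"
    "Vector_Spaces.linear tree_scale tree_scale (\<lambda>f. tree_succ f h)"
    "Vector_Spaces.linear tree_scale tree_scale (\<lambda>f. tree_succ h f)"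
    by (simp_all add: Vector_Spaces.linear_iff vector_space_tree_scale fun_eq_iff tree_scale_def)
  show "tree_prec (tree_succ f g) h = tree_succ f (tree_prec g h)"
  proof
    show "tree_prec (tree_succ f g) h t = tree_succ f (tree_prec g h) t" for t
      by (cases t)
        (simp_all add: cut_sum_mult_left[symmetric] cut_sum_mult_right[symmetric] mult.assoc,
          rule cut_sum_swap)
  qed
  show "tree_prec (tree_prec f g) h = tree_prec f (tree_prec g h) + tree_prec f (tree_succ g h)"
  proof
    show "tree_prec (tree_prec f g) h t
        = (tree_prec f (tree_prec g h) + tree_prec f (tree_succ g h)) t" for t
    proof (cases t)
      case (Node a x b)
      have "tree_prec (tree_prec f g) h t
          = cut_sum b (\<lambda>p q. cut_sum p (\<lambda>p1 p2. f (Node a x p1) * (off_leaf g p2 * off_leaf h q)))"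
        by (simp add: Node cut_sum_mult_right[symmetric] mult.assoc)
      also have "\<dots> = cut_sum b (\<lambda>p q. f (Node a x p) * off_leaf (tree_prec g h + tree_succ g h) q)"
        by (simp add: cut_sum_coassoc[of b "\<lambda>p1 p2 q. f (Node a x p1) * (off_leaf g p2 * off_leaf h q)"]
            cut_sum_mult_left cut_sum_off_leaf)
      finally show ?thesis
        by (simp add: Node off_leaf_add distrib_left cut_sum_add)
    qed simp
  qed
  show "tree_succ f (tree_succ g h) = tree_succ (tree_succ f g) h + tree_succ (tree_prec f g) h"
  proof
    show "tree_succ f (tree_succ g h) t
        = (tree_succ (tree_succ f g) h + tree_succ (tree_prec f g) h) t" for t
    proof (cases t)
      case (Node a x b)
      have "tree_succ f (tree_succ g h) t
          = cut_sum a (\<lambda>p q. cut_sum q (\<lambda>q1 q2. (off_leaf f p * off_leaf g q1) * h (Node q2 x b)))"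
        by (simp add: Node cut_sum_mult_left[symmetric] mult.assoc)
      also have "\<dots> = cut_sum a (\<lambda>p q. off_leaf (tree_prec f g + tree_succ f g) p * h (Node q x b))"
        by (simp add: cut_sum_coassoc[of a "\<lambda>p q1 q2. (off_leaf f p * off_leaf g q1) * h (Node q2 x b)", symmetric]
            cut_sum_mult_right cut_sum_off_leaf)
      finally show ?thesis
        by (simp add: Node off_leaf_add distrib_right cut_sum_add add.commute)
    qed simp
  qed
qed

section \<open>Indicator functions of trees: monomial form and linear independence\<close>

definition tree_delta :: "'x tree \<Rightarrow> 'x tree \<Rightarrow> 'k::field" where
  "tree_delta s t = (if t = s then 1 else 0)"

text \<open>The left part \<open>Node a y p\<close> of a contributing cut has
  \<open>p = Leaf\<close>, so the path runs down the left edge of the right subtree and cuts that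
  subtree off whole. As \<open>r\<close> is nonempty, \<open>off_leaf\<close> does not discard this
  cut.\<close>

lemma tree_prec_delta:
  assumes "r \<noteq> Leaf"
  shows "tree_prec (tree_delta (Node l x Leaf)) (tree_delta r) = (tree_delta (Node l x r) :: _ \<Rightarrow> 'k::field)"
proof
  show "tree_prec (tree_delta (Node l x Leaf)) (tree_delta r) t = (tree_delta (Node l x r) t :: 'k)" for t
  proof (cases t)
    case (Node a y b)
    have "tree_delta (Node l x Leaf) (Node a y p) * off_leaf (tree_delta r) q
        = (if a = l \<and> y = x then 1 else 0) * (if p = Leaf then tree_delta r q else (0::'k))" for p q
      using assms by (simp add: tree_delta_def off_leaf_def)
    then show ?thesis
      by (simp only: Node tree_prec.simps cut_sum_mult_left cut_sum_Leaf_left)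
        (simp add: tree_delta_def)
  qed (simp add: tree_delta_def)
qed

lemma tree_succ_delta:
  assumes "l \<noteq> Leaf"
  shows "tree_succ (tree_delta l) (tree_delta (Node Leaf x r)) = (tree_delta (Node l x r) :: _ \<Rightarrow> 'k::field)"
proof
  show "tree_succ (tree_delta l) (tree_delta (Node Leaf x r)) t = (tree_delta (Node l x r) t :: 'k)" for t
  proof (cases t)
    case (Node a y b)
    have "off_leaf (tree_delta l) p * tree_delta (Node Leaf x r) (Node q y b)
        = (if b = r \<and> y = x then 1 else 0) * (if q = Leaf then tree_delta l p else (0::'k))" for p q
      using assms by (simp add: tree_delta_def off_leaf_def)
    then show ?thesis
      by (simp only: Node tree_succ.simps cut_sum_mult_left cut_sum_Leaf_right)
        (simp add: tree_delta_def)
  qed (simp add: tree_delta_def)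
qed

text \<open>The indicator of \<open>Node l x r\<close> is \<open>l \<succ> (x \<prec> r)\<close> in
  terms of the indicators of \<open>l\<close> and \<open>r\<close>, the factor of an empty subtree
  being omitted.\<close>

lemma tree_delta_is_monomial:
  assumes "t \<noteq> Leaf"
  shows "\<exists>e. expr_degree e = size t \<and>
    expr_eval (\<lambda>x. tree_delta (Node Leaf x Leaf)) tree_prec tree_succ e = (tree_delta t :: _ \<Rightarrow> 'k::field)"
  using assms
proof (induction t)
  case (Node l x r)
  let ?ev = "expr_eval (\<lambda>x. tree_delta (Node Leaf x Leaf)) tree_prec tree_succ :: _ \<Rightarrow> _ \<Rightarrow> 'k"
  obtain e where e: "expr_degree e = Suc (size r)" "?ev e = tree_delta (Node Leaf x r)"
  proof (cases "r = Leaf")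
    case True
    then show ?thesis by (intro that[of "Gen x"]) simp_all
  next
    case False
    then obtain e where "expr_degree e = size r" "?ev e = tree_delta r" using Node.IH by auto
    then show ?thesis
      using False by (intro that[of "Prec (Gen x) e"]) (simp_all add: tree_prec_delta)
  qed
  show ?case
  proof (cases "l = Leaf")
    case True
    then show ?thesis using e by (intro exI[of _ e]) simp
  next
    case False
    then obtain e' where "expr_degree e' = size l" "?ev e' = tree_delta l" using Node.IH by auto
    then show ?thesis
      using False e by (intro exI[of _ "Succ e' e"]) (simp_all add: tree_succ_delta)
  qed
qed simp

lemma inj_tree_delta: "inj (tree_delta :: _ \<Rightarrow> _ \<Rightarrow> 'k::field)"
  by (metis injI one_neq_zero tree_delta_def)

lemma independent_tree_delta:
  "\<not> module.dependent tree_scale (tree_delta ` S :: ('x tree \<Rightarrow> 'k::field) set)"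
proof -
  interpret vector_space "tree_scale :: 'k \<Rightarrow> ('x tree \<Rightarrow> 'k) \<Rightarrow> _"
    by (rule vector_space_tree_scale)
  have sum_apply: "(\<Sum>v\<in>A. g v) s = (\<Sum>v\<in>A. g v s)" for g :: "('x tree \<Rightarrow> 'k) \<Rightarrow> 'x tree \<Rightarrow> 'k" and A s
    by (induction A rule: infinite_finite_induct) simp_all
  show ?thesis
    unfolding independent_explicit_finite_subsets
  proof (intro allI impI ballI)
    fix A u and v :: "'x tree \<Rightarrow> 'k"
    assume A: "A \<subseteq> tree_delta ` S" "finite A" "(\<Sum>v\<in>A. tree_scale (u v) v) = 0" "v \<in> A"
    then obtain s where s: "v = tree_delta s" by blast
    \<comment> \<open>Evaluating the linear relation at the tree \<open>s\<close> isolates the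
      coefficient of \<open>tree_delta s\<close>.\<close>
    have "u w * w s = (if w = v then u v else 0)" if w: "w \<in> A" for w
    proof -
      obtain s' where "w = tree_delta s'" using w A(1) by blast
      then show ?thesis
        by (simp add: s inj_eq[OF inj_tree_delta]) (simp add: tree_delta_def)
    qed
    then have "(\<Sum>w\<in>A. tree_scale (u w) w) s = u v"
      using A(2,4) by (simp add: sum_apply tree_scale_def)
    then show "u v = 0" unfolding A(3) by simp
  qed
qed

section \<open>Counting\<close>

text \<open>The four shapes of a nonempty tree, by which subtrees of its root are empty, correspond
  to the four rules for normal words. This serves counting only and differs from the monomials that
  realise the indicators.\<close>

fun tree_word :: "'x tree \<Rightarrow> 'x expr" where
  "tree_word (Node Leaf x Leaf) = Gen x"
| "tree_word (Node Leaf x v) = Prec (Gen x) (tree_word v)"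
| "tree_word (Node v x Leaf) = Succ (Gen x) (tree_word v)"
| "tree_word (Node u x v) = Succ (Succ (Gen x) (tree_word u)) (tree_word v)"
| "tree_word Leaf = undefined"

text \<open>Surjectivity of \<open>tree_word\<close> onto normal words, with degree matching size,
  bounds their number from above.\<close>

lemma normal_word_is_tree_word:
  "w \<in> normal_words \<Longrightarrow> \<exists>t. t \<noteq> Leaf \<and> w = tree_word t \<and> expr_degree w = size t"
proof (induction rule: normal_words.induct)
  case (1 x)
  show ?case by (intro exI[of _ "Node Leaf x Leaf"]) simp
next
  case (2 v x)
  then obtain l y r where "v = tree_word (Node l y r)" "expr_degree v = size (Node l y r)"
    by (metis tree.exhaust)
  then show ?case by (intro exI[of _ "Node Leaf x (Node l y r)"]) simp
next
  case (3 v x)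
  then obtain l y r where "v = tree_word (Node l y r)" "expr_degree v = size (Node l y r)"
    by (metis tree.exhaust)
  then show ?case by (intro exI[of _ "Node (Node l y r) x Leaf"]) simp
next
  case (4 u v x)
  then obtain l y r l' y' r' where "u = tree_word (Node l y r)" "expr_degree u = size (Node l y r)"
    "v = tree_word (Node l' y' r')" "expr_degree v = size (Node l' y' r')"
    by (metis tree.exhaust)
  then show ?case by (intro exI[of _ "Node (Node l y r) x (Node l' y' r')"]) simp
qed

section \<open>Trees of given size and the dimension of \<open>DD m\<close>\<close>

definition trees :: "nat \<Rightarrow> 'x tree set" where
  "trees m = {t. size t = m}"

lemma trees_0: "trees 0 = {Leaf}"
  by (auto simp: trees_def)

lemma trees_Suc:
  "trees (Suc m) = (\<lambda>(l, x, r). Node l x r) ` (\<Union>i\<le>m. trees i \<times> UNIV \<times> trees (m - i))"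
proof -
  have "t \<in> (\<lambda>(l, x, r). Node l x r) ` (\<Union>i\<le>m. trees i \<times> UNIV \<times> trees (m - i))"
    if "size t = Suc m" for t :: "'a tree"
  proof (cases t)
    case (Node l x r)
    then have "(l, x, r) \<in> (\<Union>i\<le>m. trees i \<times> UNIV \<times> trees (m - i))"
      using that by (auto simp: trees_def)
    then show ?thesis unfolding Node by (rule rev_image_eqI) simp
  qed (use that in simp)
  then show ?thesis by (auto simp: trees_def)
qed

lemma finite_trees: "finite (trees m :: 'x::finite tree set)"
proof (induction m rule: less_induct)
  case (less m)
  then show ?case by (cases m) (simp_all add: trees_0 trees_Suc)
qed

lemma card_trees_Suc:
  "card (trees (Suc m) :: 'x::finite tree set)
   = CARD('x) * (\<Sum>i\<le>m. card (trees i :: 'x tree set) * card (trees (m - i) :: 'x tree set))"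
proof -
  have "card (trees (Suc m) :: 'x tree set)
      = card (\<Union>i\<le>m. (trees i :: 'x tree set) \<times> (UNIV :: 'x set) \<times> (trees (m - i) :: 'x tree set))"
    unfolding trees_Suc by (intro card_image) (auto simp: inj_on_def)
  also have "\<dots> = (\<Sum>i\<le>m. card ((trees i :: 'x tree set) \<times> (UNIV :: 'x set) \<times> (trees (m - i) :: 'x tree set)))"
    \<comment> \<open>The union is disjoint because \<open>i\<close> is the size of the left
      subtree.\<close>
    by (intro card_UN_disjoint ballI finite_cartesian_product finite_trees) (auto simp: trees_def)
  finally show ?thesis
    by (simp add: card_cartesian_product sum_distrib_left mult_ac)
qed

text \<open>The dimension is squeezed between the independent indicators of trees, which lie in the
  image of \<open>DD m\<close>, and the number of normal words. For \<open>m = 0\<close> the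
  equation fails: the empty tree is counted, but no word has degree 0.\<close>

lemma dim_DD:
  fixes m :: nat
  assumes "m > 0"
  shows "dd.dim (DD m :: ('x::finite, 'k::field) free_dendriform set) = card (trees m :: 'x tree set)"
proof -
  interpret T: vector_space "tree_scale :: 'k \<Rightarrow> ('x tree \<Rightarrow> 'k) \<Rightarrow> _"
    by (rule vector_space_tree_scale)
  let ?ev = "expr_eval dd_gen dd_prec dd_succ :: 'x expr \<Rightarrow> ('x, 'k) free_dendriform"
  let ?N = "{w :: 'x expr. w \<in> normal_words \<and> expr_degree w = m}"
  have "?N \<subseteq> tree_word ` trees m"
    using normal_word_is_tree_word by (fastforce simp: trees_def)
  then have N: "finite ?N" "card ?N \<le> card (trees m :: 'x tree set)"
    using finite_trees[of m, where 'x = 'x] by (auto intro: finite_subset surj_card_le)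
  \<comment> \<open>Drawing the basis from the evaluated words makes it finite and no larger than
    \<open>?N\<close>; its image under \<open>h\<close> is then a finite spanning set for the lower
    bound.\<close>
  obtain C where C: "C \<subseteq> ?ev ` ?N" "dd.independent C" "?ev ` ?N \<subseteq> dd.span C" "card C = dd.dim (?ev ` ?N)"
    by (rule dd.basis_exists)
  have dim: "dd.dim (DD m :: ('x, 'k) free_dendriform set) = card C"
    by (simp add: C(4) DD_def)
  have span: "DD m = dd.span C"
    using C(1,3) by (auto simp: DD_def dd.span_eq intro: dd.span_superset[THEN subsetD])
  have finC: "finite C" using C(1) N(1) finite_surj by blast
  have upper: "card C \<le> card (trees m :: 'x tree set)"
    using C(1) N surj_card_le[of ?N C ?ev] by simp
  obtain h where h: "dendriform_hom dd_scale dd_prec dd_succ tree_scale tree_prec tree_succ h"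
      "\<And>x. h (dd_gen x) = (tree_delta (Node Leaf x Leaf) :: 'x tree \<Rightarrow> 'k)"
    using free_dendriform_universal[OF dendriform_algebra_tree, of "\<lambda>x. tree_delta (Node Leaf x Leaf)"]
    by blast
  interpret h: Vector_Spaces.linear dd_scale tree_scale h
    using h(1) by (simp add: dendriform_hom_def)
  have h_ev: "h (?ev e) = expr_eval (\<lambda>x. tree_delta (Node Leaf x Leaf)) tree_prec tree_succ e" for e
    using h by (induction e) (simp_all add: dendriform_hom_def)
  have "tree_delta ` (trees m) \<subseteq> h ` DD m"
  proof clarify
    fix t :: "'x tree"
    assume "t \<in> trees m"
    then have t: "size t = m" by (simp add: trees_def)
    then have "t \<noteq> Leaf" using assms by auto
    then obtain e where "expr_degree e = m" "h (?ev e) = tree_delta t"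
      using tree_delta_is_monomial[of t, where 'k = 'k] t h_ev by metis
    then show "tree_delta t \<in> h ` DD m" using expr_eval_in_DD by (metis imageI)
  qed
  also have "\<dots> = T.span (h ` C)" by (simp add: span h.span_image)
  finally have "card (tree_delta ` (trees m) :: ('x tree \<Rightarrow> 'k) set) \<le> card (h ` C)"
    using T.independent_span_bound[OF _ independent_tree_delta] finC by blast
  also have "\<dots> \<le> card C" using finC by (rule card_image_le)
  also have "card (tree_delta ` (trees m) :: ('x tree \<Rightarrow> 'k) set) = card (trees m :: 'x tree set)"
    by (intro card_image inj_on_subset[OF inj_tree_delta]) simp
  finally show ?thesis using upper dim by simp
qed

section \<open>The generating function of labelled trees and the square root\<close>

theorem theorem4p4:
  fixes n :: nat
  assumes "CARD('x::finite) = n"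
  shows "hilbert_series (DD :: nat \<Rightarrow> ('x, 'k::field) free_dendriform set) =
    (1 - 2 * of_nat n * fps_X - fps_sqrt (1 - 4 * of_nat n * fps_X)) / (2 * of_nat n * fps_X)"
proof -
  define C :: "rat fps" where "C = Abs_fps (\<lambda>m. of_nat (card (trees m :: 'x tree set)))"
  have "n > 0" using assms by auto
  \<comment> \<open>The subtracted 1 is the empty tree, since the Hilbert series starts in degree
    1.\<close>
  have hilbert: "hilbert_series (DD :: nat \<Rightarrow> ('x, 'k) free_dendriform set) = C - 1"
    by (rule fps_ext) (simp add: hilbert_series_def C_def dim_DD trees_0)
  \<comment> \<open>A nonempty tree is a root label with a pair of trees. The factor
    \<open>fps_X\<close> counts the root, so the coefficient at \<open>Suc k\<close> is the
    convolution at \<open>k\<close>.\<close>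
  have C: "C = 1 + of_nat n * fps_X * C\<^sup>2"
  proof (rule fps_ext)
    fix m
    show "fps_nth C m = fps_nth (1 + of_nat n * fps_X * C\<^sup>2) m"
    proof (cases m)
      case (Suc k)
      have "of_nat n * fps_X * C\<^sup>2 = fps_X * (fps_const (of_nat n) * C\<^sup>2)"
        by (simp add: fps_of_nat mult_ac)
      then have "fps_nth (1 + of_nat n * fps_X * C\<^sup>2) m = of_nat n * fps_nth (C\<^sup>2) k"
        by (simp only: Suc) simp
      then show ?thesis
        by (simp add: Suc C_def card_trees_Suc assms power2_eq_square fps_mult_nth atMost_atLeast0)
    qed (simp add: C_def trees_0 mult.assoc)
  qed
  \<comment> \<open>Completing the square in the quadratic equation for \<open>C\<close> yields this
    root; its constant term 1 singles it out from its negative.\<close>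
  have "fps_sqrt (1 - 4 * of_nat n * fps_X) = 1 - 2 * of_nat n * fps_X * C"
    unfolding fps_sqrt_def
  proof (rule the1_equality[OF fps_sqrt_unique])
    have "(1 - 2 * of_nat n * fps_X * C)\<^sup>2 = 1 - 4 * of_nat n * fps_X * (C - of_nat n * fps_X * C\<^sup>2)"
      by (simp add: power2_eq_square algebra_simps)
    also have "C - of_nat n * fps_X * C\<^sup>2 = 1" using C by (simp add: algebra_simps)
    finally show "fps_nth (1 - 2 * of_nat n * fps_X * C) 0 = 1 \<and>
        (1 - 2 * of_nat n * fps_X * C)\<^sup>2 = 1 - 4 * of_nat n * fps_X"
      by (simp add: mult.assoc)
  qed (simp add: mult.assoc)
  then have numerator: "1 - 2 * of_nat n * fps_X - fps_sqrt (1 - 4 * of_nat n * fps_X)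
      = (2 * of_nat n * fps_X) * (C - 1)"
    by (simp add: algebra_simps)
  \<comment> \<open>The numerator is an exact multiple of this nonzero series, so the division
    cancels without truncation.\<close>
  have "2 * of_nat n * fps_X \<noteq> (0 :: rat fps)"
    using \<open>n > 0\<close> by simp
  then show ?thesis
    unfolding hilbert numerator by (rule nonzero_mult_div_cancel_left[symmetric])
qed

end
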